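(* Let $d\in\mathbb N$, $d\ge1$, and let $K_r,\ \vec K_r,\ \vec K^{\mathrm{pi}}_r$ be the kinetic kernels defined in the context. There exists a constant $C>0$ (depending only on $d$ and the fixed function $\psi$) such that for all $r>0$ and $h\in\mathbb R^d$, $$\|\Delta_x^hK_r\|_{L^1(\mathbb R^{1+2d})}+\|\Delta_x^h\vec K^{\mathrm{pi}}_r\|_{L^1(\mathbb R^{1+2d})}+\|\Delta_x^h\vec K_r\|_{L^1(\mathbb R^{1+2d})}\le C\min\{1,\,|h|\,r^{-3}\}.$$
   Context: Points of $\mathbb R^{1+2d}$ are written $(s,y,w)$ with $s\in\mathbb R$, $y,w\in\mathbb R^d$; $\mathsf Q=4d+2$. The difference operator acts on the spatial kernel variable $y$: $[\Delta_x^hJ](s,y,w)=J(s,y+h,w)-J(s,y,w)$. Fix a nonnegative $\psi\in C_c^\infty(\mathbb R^{1+2d})$, $\psi=\psi(m_0,m_1,m_2)$ with $m_0\in\mathbb R$, $m_1,m_2\in\mathbb R^d$, with $\int\psi=1$ and $\operatorname{supp}\psi\subset(-2,-1)\times B_1(0)\times B_1(0)$. For $r>0$ let $g_1(r)=r^3\sin\log r$ and $g_2(r)=r^3\cos\log r$. For $a\in\mathbb R\setminus\{0\}$, $r>0$, let $$\mathcal A_a(r)=\begin{pmatrix} g_1(r) & a\,g_2(r)\\ a^{-1}\frac{\dot g_1(r)}{2r} & \frac{\dot g_2(r)}{2r}\end{pmatrix},\qquad \mathcal F_a(r)=\begin{pmatrix}\frac1a\,\partial_r\frac{\dot g_1(r)}{2r}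 & \partial_r\frac{\dot g_2(r)}{2r}\end{pmatrix},$$ where every scalar entry is understood as a multiple of the identity of $\mathbb R^d$, so $\mathcal A_a(r)$ acts on $\mathbb R^{2d}$ (and is invertible) and $\mathcal F_a(r)$ maps $\mathbb R^{2d}$ to $\mathbb R^d$. Write $(\mathcal A_a(r)^{-1})_{i;2}$, $i=1,2$, for the scalar entries of the second column of $\mathcal A_a(r)^{-1}$. For $r>0$, with $a=s/r^2$ and $b=\mathcal A_{a}(r)^{-1}\binom yw\in\mathbb R^{2d}$, define $$K_r(s,y,w)=2^dr^{-\mathsf Q}\psi(a,b),\qquad \vec K_r(s,y,w)=-2^dr^{-\mathsf Q}\psi(a,b)\,\mathcal F_a(r)b,$$ $$\vec K^{\mathrm{pi}}_r(s,y,w)=2^{d+1}s\,r^{-\mathsf Q-1}\sum_{i=1}^2(\mathcal A_a(r)^{-1})_{i;2}\,[\nabla_{m_i}\psi](a,b).$$ All these kernels are understood to be $0$ when $s/r^2\notin(-2,-1)$. $K_r$ is real-valued, the other two are $\mathbb R^d$-valued. *)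

theory Defs
  imports "HOL-Analysis.Analysis"
begin

text \<open>
  Points of the space \<open>\<real>\<^bsup>1+2d\<^esup>\<close> are triples \<open>(s, y, w)\<close>, with \<open>\<real>\<^bsup>d\<^esup>\<close> rendered as \<^typ>\<open>real ^ 'n\<close>
  and \<open>d = CARD('n)\<close>.  Elements of \<open>\<real>\<^bsup>2d\<^esup>\<close> are pairs \<open>(b1, b2)\<close>.
\<close>

type_synonym 'n kpoint = "real \<times> (real ^ 'n) \<times> (real ^ 'n)"

subsection \<open>Smooth functions with compact support\<close>

text \<open>
  A map is of class \<open>C\<^bsup>k+1\<^esup>\<close> iff it is differentiable and all its directional derivatives
  are of class \<open>C\<^bsup>k\<^esup>\<close>.
\<close>

fun C_k :: "nat \<Rightarrow> ('a::euclidean_space \<Rightarrow> real) \<Rightarrow> bool" where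
  "C_k 0 f \<longleftrightarrow> continuous_on UNIV f"
| "C_k (Suc k) f \<longleftrightarrow>
     f differentiable_on UNIV \<and> (\<forall>v. C_k k (\<lambda>x. frechet_derivative f (at x) v))"

definition C_infinity :: "('a::euclidean_space \<Rightarrow> real) \<Rightarrow> bool" where
  "C_infinity f \<longleftrightarrow> (\<forall>k. C_k k f)"

definition supp :: "('a::euclidean_space \<Rightarrow> real) \<Rightarrow> 'a set" where
  "supp f = closure {x. f x \<noteq> 0}"

definition gradient :: "(real ^ 'n \<Rightarrow> real) \<Rightarrow> real ^ 'n \<Rightarrow> real ^ 'n" where
  "gradient f x = (\<chi> j. frechet_derivative f (at x) (axis j 1))"

definition grad_m1 :: "('n::finite kpoint \<Rightarrow> real) \<Rightarrow> 'n kpoint \<Rightarrow> real ^ 'n" where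
  "grad_m1 \<psi> = (\<lambda>(m0, m1, m2). gradient (\<lambda>m. \<psi> (m0, m, m2)) m1)"

definition grad_m2 :: "('n::finite kpoint \<Rightarrow> real) \<Rightarrow> 'n kpoint \<Rightarrow> real ^ 'n" where
  "grad_m2 \<psi> = (\<lambda>(m0, m1, m2). gradient (\<lambda>m. \<psi> (m0, m1, m)) m2)"

subsection \<open>The $L^1$ norm and the difference operator\<close>

text \<open>The value is finite exactly for Lebesgue-integrable Borel functions.\<close>

definition L1_norm :: "('a::euclidean_space \<Rightarrow> 'b::euclidean_space) \<Rightarrow> ennreal" where
  "L1_norm f = (if f \<in> borel_measurable borel then \<integral>\<^sup>+ x. ennreal (norm (f x)) \<partial>lborel else \<infinity>)"

definition Delta_x :: "real ^ 'n \<Rightarrow> ('n::finite kpoint \<Rightarrow> 'b::minus) \<Rightarrow> 'n kpoint \<Rightarrow> 'b" where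
  "Delta_x h J = (\<lambda>(s, y, w). J (s, y + h, w) - J (s, y, w))"

subsection \<open>The kinetic trajectories\<close>

definition g1 :: "real \<Rightarrow> real" where
  "g1 r = r ^ 3 * sin (ln r)"

definition g2 :: "real \<Rightarrow> real" where
  "g2 r = r ^ 3 * cos (ln r)"

text \<open>
  A \<open>2 \<times> 2\<close> scalar matrix, or a row vector of length \<open>2\<close>, acts on \<open>\<real>\<^bsup>2d\<^esup>\<close> by reading each
  scalar entry as a multiple of the identity of \<open>\<real>\<^bsup>d\<^esup>\<close>.
\<close>

definition mat_A :: "real \<Rightarrow> real \<Rightarrow> real ^ 2 ^ 2" where
  "mat_A a r = vector
     [vector [g1 r, a * g2 r],
      vector [(1 / a) * (deriv g1 r / (2 * r)), deriv g2 r / (2 * r)]]"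

definition row_F :: "real \<Rightarrow> real \<Rightarrow> real ^ 2" where
  "row_F a r = vector
     [(1 / a) * deriv (\<lambda>\<rho>. deriv g1 \<rho> / (2 * \<rho>)) r, deriv (\<lambda>\<rho>. deriv g2 \<rho> / (2 * \<rho>)) r]"

definition row_act :: "real ^ 2 \<Rightarrow> (real ^ 'n) \<times> (real ^ 'n) \<Rightarrow> real ^ 'n" where
  "row_act R = (\<lambda>(u, v). R $ 1 *\<^sub>R u + R $ 2 *\<^sub>R v)"

definition mat_act :: "real ^ 2 ^ 2 \<Rightarrow> (real ^ 'n) \<times> (real ^ 'n) \<Rightarrow> (real ^ 'n) \<times> (real ^ 'n)" where
  "mat_act M b = (row_act (M $ 1) b, row_act (M $ 2) b)"

subsection \<open>The kinetic kernels\<close>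

definition hom_dim :: "'n::finite itself \<Rightarrow> nat" where
  "hom_dim _ = 4 * CARD('n) + 2"

definition K_ker :: "('n::finite kpoint \<Rightarrow> real) \<Rightarrow> real \<Rightarrow> 'n kpoint \<Rightarrow> real" where
  "K_ker \<psi> r = (\<lambda>(s, y, w).
     let a = s / r ^ 2; b = mat_act (matrix_inv (mat_A a r)) (y, w)
     in if a \<in> {-2<..<-1}
        then 2 ^ CARD('n) / r ^ hom_dim TYPE('n) * \<psi> (a, b)
        else 0)"

definition K_vec :: "('n::finite kpoint \<Rightarrow> real) \<Rightarrow> real \<Rightarrow> 'n kpoint \<Rightarrow> real ^ 'n" where
  "K_vec \<psi> r = (\<lambda>(s, y, w).
     let a = s / r ^ 2; b = mat_act (matrix_inv (mat_A a r)) (y, w)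
     in if a \<in> {-2<..<-1}
        then (- (2 ^ CARD('n) / r ^ hom_dim TYPE('n) * \<psi> (a, b))) *\<^sub>R row_act (row_F a r) b
        else 0)"

definition K_pi :: "('n::finite kpoint \<Rightarrow> real) \<Rightarrow> real \<Rightarrow> 'n kpoint \<Rightarrow> real ^ 'n" where
  "K_pi \<psi> r = (\<lambda>(s, y, w).
     let a = s / r ^ 2; B = matrix_inv (mat_A a r); b = mat_act B (y, w)
     in if a \<in> {-2<..<-1}
        then (2 ^ (CARD('n) + 1) * s / r ^ (hom_dim TYPE('n) + 1)) *\<^sub>R
             (B $ 1 $ 2 *\<^sub>R grad_m1 \<psi> (a, b) + B $ 2 $ 2 *\<^sub>R grad_m2 \<psi> (a, b))
        else 0)"

end

theory Submission
  imports Defs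
begin

text \<open>
  All three kernels have the same shape: with \<open>a = s / r\<^sup>2\<close> and \<open>b = A\<^sub>a(r)\<^sup>-\<^sup>1 (y, w)\<close>, each of them
  is \<open>r\<^sup>-\<^sup>Q \<Phi>(a, b)\<close>, where the profile \<open>\<Phi>\<close> depends on \<open>r\<close> only through \<open>sin (ln r)\<close> and
  \<open>cos (ln r)\<close>. Since the latter are bounded by \<open>1\<close> and \<open>a\<close> stays in \<open>(-2, -1)\<close>, the profiles are
  bounded and Lipschitz in \<open>b\<close> with constants \<open>M\<close> and \<open>L\<close> that depend on \<open>\<psi>\<close> and \<open>d\<close> only, and they
  vanish unless both components of \<open>b\<close> lie in the unit ball. For \<open>\<psi>\<close> and its first derivatives these
  properties come from smoothness and compact support; the remaining profiles are obtained from them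
  by bounded scalar factors, sums, and multiplication by a coordinate of \<open>b\<close>.

  The explicit inverse of \<open>A\<^sub>a(r)\<close> has first column of order \<open>r\<^sup>-\<^sup>3\<close>. Hence replacing \<open>y\<close> by \<open>y + h\<close>
  moves \<open>b\<close> by at most \<open>8 |h| r\<^sup>-\<^sup>3\<close>, and the difference of a kernel is at most
  \<open>r\<^sup>-\<^sup>Q min(2 M, 8 L |h| r\<^sup>-\<^sup>3)\<close>. On the other hand the bounds on \<open>A\<^sub>a(r)\<close> itself show that \<open>|b\<^sub>1|, |b\<^sub>2| < 1\<close>
  forces \<open>|y| \<le> 3 r\<^sup>3\<close> and \<open>|w| \<le> 4 r\<close>, so the difference is supported in a box and a translate of it,
  each of volume \<open>r\<^sup>2 (6 r\<^sup>3)\<^sup>d (8 r)\<^sup>d = 48\<^sup>d r\<^sup>Q\<close>. The product of height and volume is independent of \<open>r\<close>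
  up to the factor \<open>min(1, |h| r\<^sup>-\<^sup>3)\<close>; bounding the support by a box replaces the change of variables
  \<open>(s, y, w) \<mapsto> (a, b)\<close>.
\<close>

section \<open>Compactly supported functions\<close>

lemma bounded_if_zero_off_compact:
  fixes f :: "'a::euclidean_space \<Rightarrow> real"
  assumes "continuous_on UNIV f" "compact K" "\<And>x. x \<notin> K \<Longrightarrow> f x = 0"
  shows "\<exists>M\<ge>0. \<forall>x. \<bar>f x\<bar> \<le> M"
proof -
  have "compact (f ` K)"
    using assms by (meson compact_continuous_image continuous_on_subset subset_UNIV)
  then obtain M where M: "\<And>x. x \<in> K \<Longrightarrow> \<bar>f x\<bar> \<le> M"
    by (metis bounded_iff compact_imp_bounded image_eqI real_norm_def)
  have "\<bar>f x\<bar> \<le> max M 0" for x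
    using M[of x] assms(3)[of x] by (cases "x \<in> K") auto
  then show ?thesis by (intro exI[of _ "max M 0"]) auto
qed

lemma frechet_derivative_zero_off_closed:
  fixes f :: "'a::euclidean_space \<Rightarrow> real"
  assumes "closed K" "\<And>x. x \<notin> K \<Longrightarrow> f x = 0" "x \<notin> K"
  shows "frechet_derivative f (at x) = (\<lambda>v. 0)"
proof -
  have "(f has_derivative (\<lambda>v. 0)) (at x)"
    by (rule has_derivative_transform_within_open[where f = "\<lambda>x. 0" and s = "- K"])
      (use assms in \<open>auto simp: open_Compl\<close>)
  then show ?thesis
    using frechet_derivative_at by metis
qed

text \<open>
  The directional derivatives along basis vectors are continuous with compact support, hence bounded,
  and their bounds add up to a bound on the operator norm of the derivative.
\<close>

lemma lipschitz_if_C1_zero_off_compact: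
  fixes f :: "'a::euclidean_space \<Rightarrow> real"
  assumes C1: "C_k 1 f" and K: "compact K" "\<And>x. x \<notin> K \<Longrightarrow> f x = 0"
  shows "\<exists>L\<ge>0. \<forall>x y. \<bar>f x - f y\<bar> \<le> L * norm (x - y)"
proof -
  define D where "D x = frechet_derivative f (at x)" for x
  have der: "(f has_derivative D x) (at x)" for x
    using C1 unfolding D_def
    by (auto simp: differentiable_on_def frechet_derivative_works[symmetric])
  have lin: "bounded_linear (D x)" for x
    using der has_derivative_bounded_linear by blast
  have "\<exists>M\<ge>0. \<forall>x. \<bar>D x v\<bar> \<le> M" for v
  proof (rule bounded_if_zero_off_compact[OF _ K(1)])
    show "continuous_on UNIV (\<lambda>x. D x v)"
      using C1 by (auto simp: D_def)
    show "D x v = 0" if "x \<notin> K" for x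
      using frechet_derivative_zero_off_closed[OF compact_imp_closed[OF K(1)] K(2) that]
      by (simp add: D_def)
  qed
  then obtain M where M: "\<And>v. M v \<ge> 0" "\<And>v x. \<bar>D x v\<bar> \<le> M v"
    by metis
  have "norm (f x - f y) \<le> (\<Sum>v\<in>Basis. M v) * norm (x - y)" for x y
  proof (rule differentiable_bound[of UNIV f D])
    show "onorm (D x) \<le> (\<Sum>v\<in>Basis. M v)" for x
    proof -
      have "onorm (D x) \<le> (\<Sum>v\<in>Basis. norm (D x v))"
        by (rule onorm_componentwise[OF lin])
      also have "\<dots> \<le> (\<Sum>v\<in>Basis. M v)"
        using M by (intro sum_mono) auto
      finally show ?thesis .
    qed
  qed (use der in \<open>auto simp: has_derivative_at_withinI\<close>)
  then show ?thesis
    using M(1) by (intro exI[of _ "\<Sum>v\<in>Basis. M v"]) (auto simp: sum_nonneg)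
qed

lemma C_infinity_D:
  assumes "C_infinity f"
  shows "C_k 1 f" "C_k 1 (\<lambda>x. frechet_derivative f (at x) v)"
proof -
  have "C_k 1 f" "C_k (Suc 1) f"
    using assms unfolding C_infinity_def by blast+
  then show "C_k 1 f" "C_k 1 (\<lambda>x. frechet_derivative f (at x) v)"
    by auto
qed

lemma C1_differentiable: "C_k 1 f \<Longrightarrow> f differentiable (at x)"
  by (auto simp: differentiable_on_def)

lemma continuous_on_if_C1: "C_k 1 f \<Longrightarrow> continuous_on UNIV f"
  by (simp add: differentiable_imp_continuous_on)


section \<open>Bounded profiles that are Lipschitz in the last two variables\<close>

text \<open>
  The Lipschitz bound concerns the last two variables only, because the difference operator leaves
  \<open>s\<close>, and hence \<open>a = s / r\<^sup>2\<close>, unchanged. Restricting the estimates to \<open>-2 < a < -1\<close> makes the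
  class stable under factors such as \<open>1 / a\<close>.
\<close>

definition profile :: "real \<Rightarrow> real \<Rightarrow> ('n::finite kpoint \<Rightarrow> 'b::euclidean_space) \<Rightarrow> bool" where
  "profile M L \<Phi> \<longleftrightarrow> \<Phi> \<in> borel_measurable borel \<and> 0 \<le> M \<and> 0 \<le> L \<and>
     (\<forall>a\<in>{-2<..<-1}. \<forall>b. norm (\<Phi> (a, b)) \<le> M \<and>
        (\<Phi> (a, b) \<noteq> 0 \<longrightarrow> norm (fst b) < 1 \<and> norm (snd b) < 1) \<and>
        (\<forall>b'. norm (\<Phi> (a, b) - \<Phi> (a, b')) \<le> L * norm (b - b')))"

lemma profileI:
  assumes "\<Phi> \<in> borel_measurable borel" "0 \<le> M" "0 \<le> L"
    and "\<And>a b. -2 < a \<Longrightarrow> a < -1 \<Longrightarrow> norm (\<Phi> (a, b)) \<le> M"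
    and "\<And>a b. -2 < a \<Longrightarrow> a < -1 \<Longrightarrow> \<Phi> (a, b) \<noteq> 0 \<Longrightarrow> norm (fst b) < 1 \<and> norm (snd b) < 1"
    and "\<And>a b b'. -2 < a \<Longrightarrow> a < -1 \<Longrightarrow> norm (\<Phi> (a, b) - \<Phi> (a, b')) \<le> L * norm (b - b')"
  shows "profile M L \<Phi>"
  using assms by (auto simp: profile_def)

lemma profileD:
  assumes "profile M L \<Phi>"
  shows "\<Phi> \<in> borel_measurable borel" "0 \<le> M" "0 \<le> L"
    and "\<And>a b. -2 < a \<Longrightarrow> a < -1 \<Longrightarrow> norm (\<Phi> (a, b)) \<le> M"
    and "\<And>a b. -2 < a \<Longrightarrow> a < -1 \<Longrightarrow> \<Phi> (a, b) \<noteq> 0 \<Longrightarrow> norm (fst b) < 1"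
    and "\<And>a b. -2 < a \<Longrightarrow> a < -1 \<Longrightarrow> \<Phi> (a, b) \<noteq> 0 \<Longrightarrow> norm (snd b) < 1"
    and "\<And>a b b'. -2 < a \<Longrightarrow> a < -1 \<Longrightarrow> norm (\<Phi> (a, b) - \<Phi> (a, b')) \<le> L * norm (b - b')"
  using assms by (auto simp: profile_def)

lemma profile_scale:
  fixes \<Phi> :: "'n::finite kpoint \<Rightarrow> 'b::euclidean_space"
  assumes \<Phi>: "profile M L \<Phi>" and c: "c \<in> borel_measurable borel"
    and \<kappa>: "0 \<le> \<kappa>" "\<And>a. -2 < a \<Longrightarrow> a < -1 \<Longrightarrow> \<bar>c a\<bar> \<le> \<kappa>"
  shows "profile (\<kappa> * M) (\<kappa> * L) (\<lambda>m. c (fst m) *\<^sub>R \<Phi> m)"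
proof (rule profileI)
  note [measurable] = c profileD(1)[OF \<Phi>]
  have [measurable]: "(fst :: 'n kpoint \<Rightarrow> real) \<in> borel \<rightarrow>\<^sub>M borel"
    by (intro borel_measurable_continuous_onI continuous_intros)
  show "(\<lambda>m. c (fst m) *\<^sub>R \<Phi> m) \<in> borel_measurable borel"
    by measurable
  fix a :: real and b b' :: "(real ^ 'n) \<times> (real ^ 'n)" assume a: "-2 < a" "a < -1"
  show "norm (c (fst (a, b)) *\<^sub>R \<Phi> (a, b)) \<le> \<kappa> * M"
    using mult_mono[OF \<kappa>(2)[OF a] profileD(4)[OF \<Phi> a] \<kappa>(1) norm_ge_zero] by simp
  have "norm (c a *\<^sub>R \<Phi> (a, b) - c a *\<^sub>R \<Phi> (a, b')) = \<bar>c a\<bar> * norm (\<Phi> (a, b) - \<Phi> (a, b'))"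
    by (simp flip: scaleR_diff_right)
  also have "\<dots> \<le> \<kappa> * (L * norm (b - b'))"
    using profileD(7)[OF \<Phi> a] \<kappa>(2)[OF a] \<kappa>(1) by (intro mult_mono) auto
  finally show "norm (c (fst (a, b)) *\<^sub>R \<Phi> (a, b) - c (fst (a, b')) *\<^sub>R \<Phi> (a, b'))
      \<le> \<kappa> * L * norm (b - b')" by simp
qed (use profileD[OF \<Phi>] \<kappa> in auto)

lemma profile_add:
  assumes \<Phi>: "profile M L \<Phi>" and \<Psi>: "profile M' L' \<Psi>"
  shows "profile (M + M') (L + L') (\<lambda>m. \<Phi> m + \<Psi> m)"
proof (rule profileI)
  fix a b b' assume a: "-2 < (a::real)" "a < -1"
  show "norm (\<Phi> (a, b) + \<Psi> (a, b)) \<le> M + M'"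
    using profileD(4)[OF \<Phi> a] profileD(4)[OF \<Psi> a] by (meson add_mono norm_triangle_le)
  show "norm (\<Phi> (a, b) + \<Psi> (a, b) - (\<Phi> (a, b') + \<Psi> (a, b'))) \<le> (L + L') * norm (b - b')"
    using norm_triangle_mono[OF profileD(7)[OF \<Phi> a, of b b'] profileD(7)[OF \<Psi> a, of b b']]
    by (simp add: algebra_simps)
  assume "\<Phi> (a, b) + \<Psi> (a, b) \<noteq> 0"
  then have "\<Phi> (a, b) \<noteq> 0 \<or> \<Psi> (a, b) \<noteq> 0" by auto
  then show "norm (fst b) < 1 \<and> norm (snd b) < 1"
    using profileD(5,6)[OF \<Phi> a] profileD(5,6)[OF \<Psi> a] by blast
qed (use profileD[OF \<Phi>] profileD[OF \<Psi>] in auto)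

text \<open>
  A linear factor is unbounded, but at a point where \<open>f\<close> does not vanish it is at most \<open>1\<close>; the
  difference of the products is expanded around such a point.
\<close>

lemma profile_times_linear:
  fixes f :: "'n::finite kpoint \<Rightarrow> real"
    and T :: "(real ^ 'n) \<times> (real ^ 'n) \<Rightarrow> 'b::euclidean_space"
  assumes f: "profile M L f" and T: "linear T" "\<And>b. norm (T b) \<le> norm b"
    and T1: "\<And>b. norm (fst b) < 1 \<Longrightarrow> norm (snd b) < 1 \<Longrightarrow> norm (T b) \<le> 1"
  shows "profile M (M + L) (\<lambda>m. f m *\<^sub>R T (snd m))"
proof (rule profileI)
  note [measurable] = profileD(1)[OF f]
  have "continuous_on UNIV (\<lambda>m :: 'n kpoint. T (snd m))"
    by (intro linear_continuous_on_compose[OF _ T(1)] continuous_intros)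
  then have [measurable]: "(\<lambda>m :: 'n kpoint. T (snd m)) \<in> borel_measurable borel"
    by (rule borel_measurable_continuous_onI)
  show "(\<lambda>m. f m *\<^sub>R T (snd m)) \<in> borel_measurable borel"
    by measurable
  fix a :: real and b b' :: "(real ^ 'n) \<times> (real ^ 'n)" assume a: "-2 < a" "a < -1"
  have small: "norm (T b) \<le> 1" if "f (a, b) \<noteq> 0" for b
    using T1 profileD(5,6)[OF f a that] by blast
  show "norm (f (a, b) *\<^sub>R T (snd (a, b))) \<le> M"
  proof (cases "f (a, b) = 0")
    case False
    show ?thesis
      using mult_mono[OF profileD(4)[OF f a] small[OF False], of b] profileD(2)[OF f] by simp
  qed (use profileD(2)[OF f] in auto)
  \<comment> \<open>The linear factor is evaluated at the point where it is known to be small.\<close>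
  have main: "norm (f (a, b) *\<^sub>R T b - f (a, b') *\<^sub>R T b') \<le> (M + L) * norm (b - b')"
    if "f (a, b) \<noteq> 0" for b b'
  proof -
    have "f (a, b) *\<^sub>R T b - f (a, b') *\<^sub>R T b'
        = f (a, b') *\<^sub>R T (b - b') + (f (a, b) - f (a, b')) *\<^sub>R T b"
      by (simp add: linear_diff[OF T(1)] algebra_simps)
    also have "norm \<dots> \<le> M * norm (b - b') + (L * norm (b - b')) * 1"
    proof (rule norm_triangle_mono)
      show "norm (f (a, b') *\<^sub>R T (b - b')) \<le> M * norm (b - b')"
        using mult_mono[OF profileD(4)[OF f a] T(2) profileD(2)[OF f] norm_ge_zero] by simp
      show "norm ((f (a, b) - f (a, b')) *\<^sub>R T b) \<le> (L * norm (b - b')) * 1"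
        using mult_mono[OF profileD(7)[OF f a] small[OF that]] profileD(3)[OF f] by simp
    qed
    finally show ?thesis by (simp add: algebra_simps)
  qed
  show "norm (f (a, b) *\<^sub>R T (snd (a, b)) - f (a, b') *\<^sub>R T (snd (a, b'))) \<le> (M + L) * norm (b - b')"
  proof (cases "f (a, b) = 0")
    case True
    show ?thesis
      using main[of b' b] True profileD(2,3)[OF f]
      by (cases "f (a, b') = 0") (auto simp: norm_minus_commute)
  qed (use main in simp)
  assume "f (a, b) *\<^sub>R T (snd (a, b)) \<noteq> 0"
  then show "norm (fst b) < 1 \<and> norm (snd b) < 1"
    using profileD(5,6)[OF f a] by auto
qed (use profileD[OF f] in auto)

lemma profile_if_C1_zero_off_compact:
  fixes f :: "'n::finite kpoint \<Rightarrow> real"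
  assumes "C_k 1 f" "compact K" "\<And>m. m \<notin> K \<Longrightarrow> f m = 0"
    and "K \<subseteq> {-2<..<-1} \<times> ball 0 1 \<times> ball 0 1"
  shows "\<exists>M L. profile M L f"
proof -
  note cont = continuous_on_if_C1[OF assms(1)]
  obtain M where M: "M \<ge> 0" "\<And>m. \<bar>f m\<bar> \<le> M"
    using bounded_if_zero_off_compact[OF cont assms(2,3)] by auto
  obtain L where L: "L \<ge> 0" "\<And>m m'. \<bar>f m - f m'\<bar> \<le> L * norm (m - m')"
    using lipschitz_if_C1_zero_off_compact[OF assms(1-3)] by auto
  have "profile M L f"
  proof (rule profileI)
    show "f \<in> borel_measurable borel"
      using cont by (rule borel_measurable_continuous_onI)
    show "norm (f (a, b) - f (a, b')) \<le> L * norm (b - b')" for a b b'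
      using L(2)[of "(a, b)" "(a, b')"] by simp
    show "norm (fst b) < 1 \<and> norm (snd b) < 1" if "f (a, b) \<noteq> 0" for a b
      using that assms(3,4) by (cases b) force
  qed (use M L in auto)
  then show ?thesis by blast
qed

lemma profile_sum:
  assumes "finite I" "\<And>i. i \<in> I \<Longrightarrow> \<exists>M L. profile M L (\<Phi> i)"
  shows "\<exists>M L. profile M L (\<lambda>m. \<Sum>i\<in>I. \<Phi> i m)"
  using assms
proof (induction I rule: finite_induct)
  case empty
  have "profile 0 0 (\<lambda>m. 0)" by (rule profileI) auto
  then show ?case by auto
next
  case (insert i I)
  obtain M L where i: "profile M L (\<Phi> i)"
    using insert.prems by blast
  obtain M' L' where I: "profile M' L' (\<lambda>m. \<Sum>i\<in>I. \<Phi> i m)"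
    using insert.IH insert.prems by blast
  from profile_add[OF i I] insert.hyps show ?case by auto
qed

lemma profile_vector:
  fixes \<Phi> :: "'n::finite kpoint \<Rightarrow> real ^ 'm"
  assumes "\<And>j. \<exists>M L. profile M L (\<lambda>m. \<Phi> m $ j)"
  shows "\<exists>M L. profile M L \<Phi>"
proof -
  have "\<exists>M L. profile M L (\<lambda>m. \<Phi> m $ j *\<^sub>R axis j (1::real))" for j
  proof -
    obtain M L where p: "profile M L (\<lambda>m. \<Phi> m $ j)" using assms by blast
    have "profile M L (\<lambda>m. \<Phi> m $ j *\<^sub>R axis j (1::real))"
    proof (rule profileI)
      show "(\<lambda>m. \<Phi> m $ j *\<^sub>R axis j (1::real)) \<in> borel_measurable borel"
        using profileD(1)[OF p] by measurable
    qed (use profileD(2-)[OF p] in \<open>auto simp flip: scaleR_diff_left\<close>)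
    then show ?thesis by blast
  qed
  then have "\<exists>M L. profile M L (\<lambda>m. \<Sum>j\<in>UNIV. \<Phi> m $ j *\<^sub>R axis j (1::real))"
    by (intro profile_sum) auto
  moreover have "(\<Sum>j\<in>UNIV. x $ j *\<^sub>R axis j (1::real)) = x" for x :: "real ^ 'm"
    by (simp add: vec_eq_iff axis_def if_distrib sum.delta cong: if_cong)
  ultimately show ?thesis by simp
qed

section \<open>Partial gradients of a test function\<close>

lemma grad_m1_nth:
  assumes "\<psi> differentiable (at m)"
  shows "grad_m1 \<psi> m $ j = frechet_derivative \<psi> (at m) (0, axis j 1, 0)"
proof -
  obtain a b c where m: "m = (a, b, c)" by (cases m)
  have "((\<lambda>x. \<psi> (a, x, c)) has_derivative (\<lambda>v. frechet_derivative \<psi> (at m) (0, v, 0))) (at b)"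
  proof (rule has_derivative_compose[where g = \<psi>])
    show "((\<lambda>x. (a, x, c)) has_derivative (\<lambda>v. (0, v, 0))) (at b)"
      by (intro has_derivative_Pair has_derivative_const has_derivative_ident)
    show "(\<psi> has_derivative frechet_derivative \<psi> (at m)) (at (a, b, c))"
      using assms by (simp add: m frechet_derivative_works)
  qed
  from frechet_derivative_at[OF this] show ?thesis
    by (simp add: grad_m1_def gradient_def m fun_eq_iff)
qed

lemma grad_m2_nth:
  assumes "\<psi> differentiable (at m)"
  shows "grad_m2 \<psi> m $ j = frechet_derivative \<psi> (at m) (0, 0, axis j 1)"
proof -
  obtain a b c where m: "m = (a, b, c)" by (cases m)
  have "((\<lambda>x. \<psi> (a, b, x)) has_derivative (\<lambda>v. frechet_derivative \<psi> (at m) (0, 0, v))) (at c)"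
  proof (rule has_derivative_compose[where g = \<psi>])
    show "((\<lambda>x. (a, b, x)) has_derivative (\<lambda>v. (0, 0, v))) (at c)"
      by (intro has_derivative_Pair has_derivative_const has_derivative_ident)
    show "(\<psi> has_derivative frechet_derivative \<psi> (at m)) (at (a, b, c))"
      using assms by (simp add: m frechet_derivative_works)
  qed
  from frechet_derivative_at[OF this] show ?thesis
    by (simp add: grad_m2_def gradient_def m fun_eq_iff)
qed

text \<open>
  The components of the partial gradients are directional derivatives of \<open>\<psi>\<close> on the full space, so
  they are again continuously differentiable and vanish off the support of \<open>\<psi>\<close>.
\<close>

lemma test_function_profiles:
  fixes \<psi> :: "'n::finite kpoint \<Rightarrow> real"
  assumes smooth: "C_infinity \<psi>" and cpt: "compact (supp \<psi>)"
    and sub: "supp \<psi> \<subseteq> {-2<..<-1} \<times> ball 0 1 \<times> ball 0 1"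
  shows "\<exists>M L. profile M L \<psi>" "\<exists>M L. profile M L (grad_m1 \<psi>)" "\<exists>M L. profile M L (grad_m2 \<psi>)"
proof -
  have off: "\<psi> m = 0" if "m \<notin> supp \<psi>" for m
    using that closure_subset[of "{x. \<psi> x \<noteq> 0}"] by (auto simp: supp_def)
  show "\<exists>M L. profile M L \<psi>"
    by (rule profile_if_C1_zero_off_compact[OF C_infinity_D(1)[OF smooth] cpt off sub])
  have D: "\<exists>M L. profile M L (\<lambda>m. frechet_derivative \<psi> (at m) v)" for v
    by (rule profile_if_C1_zero_off_compact[OF C_infinity_D(2)[OF smooth] cpt _ sub])
      (simp add: frechet_derivative_zero_off_closed[OF compact_imp_closed[OF cpt] off])
  have diff: "\<psi> differentiable (at m)" for m
    by (rule C1_differentiable[OF C_infinity_D(1)[OF smooth]])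
  show "\<exists>M L. profile M L (grad_m1 \<psi>)"
    by (rule profile_vector) (simp add: grad_m1_nth[OF diff] D)
  show "\<exists>M L. profile M L (grad_m2 \<psi>)"
    by (rule profile_vector) (simp add: grad_m2_nth[OF diff] D)
qed

section \<open>The matrix of the kinetic trajectories and its inverse\<close>

lemma deriv_g1: "r > 0 \<Longrightarrow> deriv g1 r = r^2 * (3 * sin (ln r) + cos (ln r))"
  unfolding g1_def
  by (rule DERIV_imp_deriv) (auto intro!: derivative_eq_intros simp: field_simps power2_eq_square power3_eq_cube)

lemma deriv_g2: "r > 0 \<Longrightarrow> deriv g2 r = r^2 * (3 * cos (ln r) - sin (ln r))"
  unfolding g2_def
  by (rule DERIV_imp_deriv) (auto intro!: derivative_eq_intros simp: field_simps power2_eq_square power3_eq_cube)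

lemma deriv_velocity1:
  assumes r: "r > 0"
  shows "deriv (\<lambda>\<rho>. deriv g1 \<rho> / (2 * \<rho>)) r = sin (ln r) + 2 * cos (ln r)"
proof -
  have "eventually (\<lambda>\<rho>. \<rho> \<in> {0<..}) (nhds r)"
    using r by (intro eventually_nhds_in_open) auto
  then have "eventually (\<lambda>\<rho>. deriv g1 \<rho> / (2 * \<rho>) = \<rho> * (3 * sin (ln \<rho>) + cos (ln \<rho>)) / 2) (nhds r)"
    by eventually_elim (simp add: deriv_g1 power2_eq_square)
  then have "deriv (\<lambda>\<rho>. deriv g1 \<rho> / (2 * \<rho>)) r = deriv (\<lambda>\<rho>. \<rho> * (3 * sin (ln \<rho>) + cos (ln \<rho>)) / 2) r"
    by (rule deriv_cong_ev) simp
  also have "\<dots> = sin (ln r) + 2 * cos (ln r)"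
    using r by (intro DERIV_imp_deriv) (auto intro!: derivative_eq_intros simp: field_simps)
  finally show ?thesis .
qed

lemma deriv_velocity2:
  assumes r: "r > 0"
  shows "deriv (\<lambda>\<rho>. deriv g2 \<rho> / (2 * \<rho>)) r = cos (ln r) - 2 * sin (ln r)"
proof -
  have "eventually (\<lambda>\<rho>. \<rho> \<in> {0<..}) (nhds r)"
    using r by (intro eventually_nhds_in_open) auto
  then have "eventually (\<lambda>\<rho>. deriv g2 \<rho> / (2 * \<rho>) = \<rho> * (3 * cos (ln \<rho>) - sin (ln \<rho>)) / 2) (nhds r)"
    by eventually_elim (simp add: deriv_g2 power2_eq_square)
  then have "deriv (\<lambda>\<rho>. deriv g2 \<rho> / (2 * \<rho>)) r = deriv (\<lambda>\<rho>. \<rho> * (3 * cos (ln \<rho>) - sin (ln \<rho>)) / 2) r"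
    by (rule deriv_cong_ev) simp
  also have "\<dots> = cos (ln r) - 2 * sin (ln r)"
    using r by (intro DERIV_imp_deriv) (auto intro!: derivative_eq_intros simp: field_simps)
  finally show ?thesis .
qed

lemma matrix_inv_unique:
  fixes A B :: "real ^ 'n ^ 'n"
  assumes "A ** B = mat 1" "B ** A = mat 1"
  shows "matrix_inv A = B"
proof -
  have "A ** matrix_inv A = mat 1 \<and> matrix_inv A ** A = mat 1"
    unfolding matrix_inv_def by (rule someI[of _ B]) (use assms in simp)
  then show ?thesis
    by (metis assms(1) matrix_mul_assoc matrix_mul_lid matrix_mul_rid)
qed

text \<open>
  The inverse of \<open>A\<^sub>a(r)\<close>, obtained from its determinant \<open>- r\<^sup>4 / 2\<close>.
\<close>

definition inv_A :: "real \<Rightarrow> real \<Rightarrow> real ^ 2 ^ 2" where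
  "inv_A a r = vector
     [vector [(sin (ln r) - 3 * cos (ln r)) / r ^ 3, 2 * a * cos (ln r) / r],
      vector [(3 * sin (ln r) + cos (ln r)) / (a * r ^ 3), - 2 * sin (ln r) / r]]"

lemma mat_A_inv_A:
  assumes "r > 0" "a \<noteq> 0"
  shows "mat_A a r ** inv_A a r = mat 1"
proof -
  have sc: "sin (ln r) ^ 2 = 1 - cos (ln r) ^ 2"
    using sin_cos_squared_add[of "ln r"] by linarith
  show ?thesis
    using assms
    by (simp add: mat_A_def inv_A_def vec_eq_iff forall_2 matrix_matrix_mult_def sum_2 mat_def g1_def
        g2_def deriv_g1 deriv_g2 vector_2)
      (simp add: field_simps power2_eq_square power3_eq_cube sc[unfolded power2_eq_square])
qed

lemma matrix_inv_mat_A: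
  assumes "r > 0" "a \<noteq> 0"
  shows "matrix_inv (mat_A a r) = inv_A a r"
  using mat_A_inv_A[OF assms] by (intro matrix_inv_unique) (simp_all add: matrix_left_right_inverse)

lemma row_F_eq:
  "r > 0 \<Longrightarrow> row_F a r = vector [(sin (ln r) + 2 * cos (ln r)) / a, cos (ln r) - 2 * sin (ln r)]"
  by (simp add: row_F_def deriv_velocity1 deriv_velocity2)


lemma mat_act_mult: "mat_act A (mat_act B p) = mat_act (A ** B) p"
  by (cases p)
    (simp add: mat_act_def row_act_def matrix_matrix_mult_def sum_2 algebra_simps)

lemma mat_act_one: "mat_act (mat 1) p = p"
  by (cases p) (simp add: mat_act_def row_act_def mat_def)

lemma mat_act_diff: "mat_act A (p - q) = mat_act A p - mat_act A q"
  by (cases p, cases q) (simp add: mat_act_def row_act_def algebra_simps)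

lemma mat_act_inv_A:
  "mat_act (inv_A a r) (y, w) =
     (((sin (ln r) - 3 * cos (ln r)) / r ^ 3) *\<^sub>R y + (2 * a * cos (ln r) / r) *\<^sub>R w,
      ((3 * sin (ln r) + cos (ln r)) / (a * r ^ 3)) *\<^sub>R y + (- 2 * sin (ln r) / r) *\<^sub>R w)"
  by (simp add: mat_act_def row_act_def inv_A_def)

lemma abs_lin_sin_cos_le:
  fixes x :: real
  shows "\<bar>p * sin x + q * cos x\<bar> \<le> \<bar>p\<bar> + \<bar>q\<bar>"
proof -
  have "\<bar>p * sin x\<bar> \<le> \<bar>p\<bar>" "\<bar>q * cos x\<bar> \<le> \<bar>q\<bar>"
    by (auto simp: abs_mult mult_left_le)
  then show ?thesis by linarith
qed

text \<open>
  The displacement of \<open>b\<close> under a translation of \<open>y\<close> by \<open>h\<close>: both scalar entries of the first column of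
  the inverse are at most \<open>4 / r\<^sup>3\<close>, the second one because \<open>\<bar>a\<bar> > 1\<close>.
\<close>

lemma norm_mat_act_inv_A_le:
  assumes r: "r > 0" and a: "-2 < a" "a < -1"
  shows "norm (mat_act (inv_A a r) (h, 0)) \<le> 8 * (norm h / r ^ 3)"
proof -
  have "\<bar>(sin (ln r) - 3 * cos (ln r)) / r ^ 3\<bar> \<le> 4 / r ^ 3"
    using abs_lin_sin_cos_le[of 1 "ln r" "-3"] r by (simp add: divide_right_mono)
  then have 1: "norm (((sin (ln r) - 3 * cos (ln r)) / r ^ 3) *\<^sub>R h) \<le> 4 / r ^ 3 * norm h"
    unfolding norm_scaleR by (rule mult_right_mono) simp
  have "\<bar>3 * sin (ln r) + cos (ln r)\<bar> / (\<bar>a\<bar> * r ^ 3) \<le> 4 / (1 * r ^ 3)"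
    using abs_lin_sin_cos_le[of 3 "ln r" 1] r a by (intro frac_le mult_right_mono) auto
  then have "\<bar>(3 * sin (ln r) + cos (ln r)) / (a * r ^ 3)\<bar> \<le> 4 / r ^ 3"
    using r by (simp add: abs_mult)
  then have 2: "norm (((3 * sin (ln r) + cos (ln r)) / (a * r ^ 3)) *\<^sub>R h) \<le> 4 / r ^ 3 * norm h"
    unfolding norm_scaleR by (rule mult_right_mono) simp
  show ?thesis
    unfolding mat_act_inv_A using order_trans[OF norm_Pair_le add_mono[OF 1 2]] by simp
qed

lemma norm_mat_act_mat_A_le:
  assumes r: "r > 0" and a: "-2 < a" "a < -1"
    and b: "norm (fst b) \<le> 1" "norm (snd b) \<le> 1"
  shows "norm (fst (mat_act (mat_A a r) b)) \<le> 3 * r ^ 3"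
    and "norm (snd (mat_act (mat_A a r) b)) \<le> 4 * r"
proof -
  obtain u v where uv: "b = (u, v)" by (cases b)
  have comb: "norm (p *\<^sub>R u + q *\<^sub>R v) \<le> P + Q" if "\<bar>p\<bar> \<le> P" "\<bar>q\<bar> \<le> Q" for p q P Q :: real
    using mult_mono[OF that(1), of "norm u" 1] mult_mono[OF that(2), of "norm v" 1] b that
    by (intro norm_triangle_le add_mono) (auto simp: uv)
  have 1: "\<bar>g1 r\<bar> \<le> r ^ 3"
    using r by (simp add: g1_def abs_mult mult_left_le)
  have "\<bar>a\<bar> * \<bar>g2 r\<bar> \<le> 2 * r ^ 3"
    using r a by (intro mult_mono) (auto simp: g2_def abs_mult mult_left_le)
  then have 2: "\<bar>a * g2 r\<bar> \<le> 2 * r ^ 3"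
    by (simp add: abs_mult)
  have "\<bar>3 * sin (ln r) + cos (ln r)\<bar> / (2 * \<bar>a\<bar>) * r \<le> 4 / (2 * 1) * r"
    using abs_lin_sin_cos_le[of 3 "ln r" 1] r a by (intro frac_le mult_right_mono) auto
  then have 3: "\<bar>(1 / a) * (deriv g1 r / (2 * r))\<bar> \<le> 2 * r"
    using r by (simp add: deriv_g1 abs_mult power2_eq_square mult_ac)
  have "\<bar>- sin (ln r) + 3 * cos (ln r)\<bar> / 2 * r \<le> 4 / 2 * r"
    using abs_lin_sin_cos_le[of "-1" "ln r" 3] r by (intro divide_right_mono mult_right_mono) auto
  then have 4: "\<bar>deriv g2 r / (2 * r)\<bar> \<le> 2 * r"
    using r by (simp add: deriv_g2 abs_mult power2_eq_square mult_ac)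
  show "norm (fst (mat_act (mat_A a r) b)) \<le> 3 * r ^ 3"
    using comb[OF 1 2] by (simp add: uv mat_act_def row_act_def mat_A_def)
  show "norm (snd (mat_act (mat_A a r) b)) \<le> 4 * r"
    using comb[OF 3 4] by (simp add: uv mat_act_def row_act_def mat_A_def)
qed

text \<open>
  This confines the support of a kernel to a box, by applying \<open>A\<^sub>a(r)\<close> to \<open>b\<close>.
\<close>

lemma norm_le_if_mat_act_inv_A_small:
  assumes r: "r > 0" and a: "-2 < a" "a < -1"
    and b: "norm (fst (mat_act (inv_A a r) (y, w))) < 1" "norm (snd (mat_act (inv_A a r) (y, w))) < 1"
  shows "norm y \<le> 3 * r ^ 3" "norm w \<le> 4 * r"
proof -
  have "mat_act (mat_A a r) (mat_act (inv_A a r) (y, w)) = (y, w)"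
    using r a by (simp add: mat_act_mult mat_A_inv_A mat_act_one)
  then show "norm y \<le> 3 * r ^ 3" "norm w \<le> 4 * r"
    using norm_mat_act_mat_A_le[OF r a less_imp_le[OF b(1)] less_imp_le[OF b(2)]] by simp_all
qed

section \<open>Differences of the rescaled kernels\<close>

text \<open>
  A box that contains all \<open>(s, y, w)\<close> for which a kernel is nonzero at \<open>(s, y + h, w)\<close>.
\<close>

definition kin_box :: "real \<Rightarrow> real ^ 'n \<Rightarrow> 'n::finite kpoint set" where
  "kin_box r h = {- 2 * r ^ 2..- (r ^ 2)} \<times>
     cbox ((\<chi> i. - 3 * r ^ 3) - h) ((\<chi> i. 3 * r ^ 3) - h) \<times> cbox (\<chi> i. - 4 * r) (\<chi> i. 4 * r)"

lemma kin_box_borel: "kin_box r h \<in> sets borel"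
  by (auto simp: kin_box_def intro!: borel_closed closed_Times)

lemma emeasure_kin_box:
  assumes r: "r > 0"
  shows "emeasure lborel (kin_box r h :: 'n::finite kpoint set)
    = ennreal (48 ^ CARD('n) * r ^ hom_dim TYPE('n))"
proof -
  have box: "kin_box r h = cbox (- 2 * r ^ 2, (\<chi> i. - 3 * r ^ 3) - h, \<chi> i. - 4 * r)
      (- (r ^ 2), (\<chi> i. 3 * r ^ 3) - h, \<chi> i. 4 * r)"
    by (simp add: kin_box_def cbox_Pair_eq)
  have 1: "measure lborel (cbox ((\<chi> i. - 3 * r ^ 3) - h) ((\<chi> i. 3 * r ^ 3) - h)) = (6 * r ^ 3) ^ CARD('n)"
    using r by (subst content_cbox_cart) (auto simp: interval_eq_empty_cart not_less)
  have 2: "measure lborel (cbox (\<chi> i. - 4 * r) (\<chi> i. 4 * r) :: (real ^ 'n) set) = (8 * r) ^ CARD('n)"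
    using r by (subst content_cbox_cart) (auto simp: interval_eq_empty_cart not_less)
  have "measure lborel (kin_box r h :: 'n kpoint set) = r ^ 2 * ((6 * r ^ 3) ^ CARD('n) * (8 * r) ^ CARD('n))"
    unfolding box content_Pair 1 2 using r by simp
  also have "\<dots> = r ^ 2 * (48 * r ^ 4) ^ CARD('n)"
    unfolding power_mult_distrib[symmetric] by (simp add: power3_eq_cube power4_eq_xxxx mult.assoc)
  also have "\<dots> = 48 ^ CARD('n) * r ^ hom_dim TYPE('n)"
    by (simp add: hom_dim_def power_mult_distrib power_add power_mult power2_eq_square)
  finally have "measure lborel (kin_box r h :: 'n kpoint set) = 48 ^ CARD('n) * r ^ hom_dim TYPE('n)" .
  moreover have "emeasure lborel (kin_box r h) < \<infinity>"
    unfolding box by (rule emeasure_lborel_cbox_finite)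
  ultimately show ?thesis
    by (simp add: emeasure_eq_ennreal_measure less_top)
qed

lemma mem_kin_box:
  fixes y w :: "real ^ 'n"
  assumes r: "r > 0" and a: "-2 < s / r ^ 2" "s / r ^ 2 < -1"
    and "norm (y + h) \<le> 3 * r ^ 3" "norm w \<le> 4 * r"
  shows "(s, y, w) \<in> kin_box r h"
proof -
  have "\<bar>(y + h) $ i\<bar> \<le> 3 * r ^ 3" "\<bar>w $ i\<bar> \<le> 4 * r" for i
    using assms(4,5) component_le_norm_cart[of "y + h" i] component_le_norm_cart[of w i] by linarith+
  then have "- (3 * r ^ 3) \<le> y $ i + h $ i" "y $ i + h $ i \<le> 3 * r ^ 3" "- (4 * r) \<le> w $ i" "w $ i \<le> 4 * r" for i
    by (simp_all add: abs_le_iff) (smt (verit))+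
  moreover have "- 2 * r ^ 2 \<le> s" "s \<le> - (r ^ 2)"
    using a r by (simp_all add: field_simps)
  ultimately show ?thesis
    by (auto simp: kin_box_def mem_box_cart algebra_simps)
qed

text \<open>
  The common form of the three kernels; powers of \<open>r\<close> other than \<open>r\<^sup>-\<^sup>Q\<close> cancel against those in the
  entries of the matrices.
\<close>

definition profile_kernel :: "('n::finite kpoint \<Rightarrow> 'b::euclidean_space) \<Rightarrow> real \<Rightarrow> 'n kpoint \<Rightarrow> 'b" where
  "profile_kernel \<Phi> r = (\<lambda>(s, y, w).
     let a = s / r ^ 2 in
     if a \<in> {-2<..<-1} then (1 / r ^ hom_dim TYPE('n)) *\<^sub>R \<Phi> (a, mat_act (inv_A a r) (y, w)) else 0)"

lemma profile_kernel_borel: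
  fixes \<Phi> :: "'n::finite kpoint \<Rightarrow> 'b::euclidean_space"
  assumes [measurable]: "\<Phi> \<in> borel_measurable borel"
  shows "profile_kernel \<Phi> r \<in> borel_measurable borel"
proof -
  have [measurable]: "(\<lambda>p :: 'n kpoint. fst p) \<in> borel_measurable borel"
      "(\<lambda>p :: 'n kpoint. fst (snd p)) \<in> borel_measurable borel"
      "(\<lambda>p :: 'n kpoint. snd (snd p)) \<in> borel_measurable borel"
    by (intro borel_measurable_continuous_onI continuous_intros)+
  have "(\<lambda>p :: 'n kpoint. (fst p / r ^ 2, mat_act (inv_A (fst p / r ^ 2) r) (fst (snd p), snd (snd p))))
      \<in> borel_measurable borel"
    unfolding mat_act_inv_A by (intro borel_measurable_Pair) measurable
  from measurable_compose[OF this assms]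
  have [measurable]: "(\<lambda>p :: 'n kpoint.
      \<Phi> (fst p / r ^ 2, mat_act (inv_A (fst p / r ^ 2) r) (fst (snd p), snd (snd p))))
      \<in> borel_measurable borel" .
  show ?thesis
    unfolding profile_kernel_def Let_def case_prod_beta by measurable
qed

lemma Delta_x_borel:
  fixes J :: "'n::finite kpoint \<Rightarrow> 'b::euclidean_space"
  assumes "J \<in> borel_measurable borel"
  shows "Delta_x h J \<in> borel_measurable borel"
proof -
  have "(\<lambda>p :: 'n kpoint. (fst p, fst (snd p) + h, snd (snd p))) \<in> borel_measurable borel"
    by (intro borel_measurable_continuous_onI continuous_intros)
  from measurable_compose[OF this assms] show ?thesis
    using assms unfolding Delta_x_def case_prod_beta by simp
qed

text \<open>
  The integrand is bounded both by the sup norm and by the Lipschitz estimate, and it vanishes off two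
  boxes whose volume compensates the factor \<open>r\<^sup>-\<^sup>Q\<close>.
\<close>

lemma L1_norm_Delta_x_profile_kernel:
  fixes \<Phi> :: "'n::finite kpoint \<Rightarrow> 'b::euclidean_space"
  assumes \<Phi>: "profile M L \<Phi>" and r: "r > 0"
  shows "L1_norm (Delta_x h (profile_kernel \<Phi> r))
    \<le> ennreal (2 * 48 ^ CARD('n) * (2 * M + 8 * L) * min 1 (norm h / r ^ 3))"
proof -
  define Q where "Q = hom_dim TYPE('n)"
  define \<mu> where "\<mu> = (2 * M + 8 * L) * min 1 (norm h / r ^ 3)"
  have \<mu>: "0 \<le> \<mu>"
    using r profileD(2,3)[OF \<Phi>] by (simp add: \<mu>_def)
  have rQ: "0 < r ^ Q" using r by simp
  let ?B = "kin_box r 0 \<union> kin_box r h"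
  have vanish: "\<Phi> (s / r ^ 2, mat_act (inv_A (s / r ^ 2) r) (y + k, w)) = 0"
    if "-2 < s / r ^ 2" "s / r ^ 2 < -1" "(s, y, w) \<notin> kin_box r k" for s y w k
    using that profileD(5,6)[OF \<Phi> that(1,2)] mem_kin_box[OF r that(1,2)]
      norm_le_if_mat_act_inv_A_small[OF r that(1,2)] by blast
  have pointwise: "norm (Delta_x h (profile_kernel \<Phi> r) p) \<le> \<mu> / r ^ Q * indicator ?B p" for p
  proof -
    obtain s y w where p: "p = (s, y, w)" by (cases p)
    define a where "a = s / r ^ 2"
    define b b' where "b = mat_act (inv_A a r) (y, w)" and "b' = mat_act (inv_A a r) (y + h, w)"
    show ?thesis
    proof (cases "-2 < a \<and> a < -1")
      case True
      then have a: "-2 < a" "a < -1" by auto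
      have D: "Delta_x h (profile_kernel \<Phi> r) p = (1 / r ^ Q) *\<^sub>R (\<Phi> (a, b') - \<Phi> (a, b))"
        using a by (simp add: p Delta_x_def profile_kernel_def Q_def Let_def a_def b_def b'_def
            scaleR_diff_right)
      show ?thesis
      proof (cases "p \<in> ?B")
        case False
        then have "\<Phi> (a, b') = 0" "\<Phi> (a, b) = 0"
          using vanish[of s y w h] vanish[of s y w 0] a by (auto simp: p a_def b_def b'_def)
        then show ?thesis using False by (simp add: D)
      next
        case inB: True
        let ?X = "norm (\<Phi> (a, b') - \<Phi> (a, b))"
        have "?X \<le> 2 * M"
          using norm_triangle_le_diff[OF add_mono[OF profileD(4)[OF \<Phi> a] profileD(4)[OF \<Phi> a]]]
          by simp
        moreover have "?X \<le> 8 * L * (norm h / r ^ 3)"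
        proof -
          have "b' - b = mat_act (inv_A a r) (h, 0)"
            by (simp add: b_def b'_def flip: mat_act_diff)
          then have "norm (b' - b) \<le> 8 * (norm h / r ^ 3)"
            using norm_mat_act_inv_A_le[OF r a] by simp
          then have "L * norm (b' - b) \<le> L * (8 * (norm h / r ^ 3))"
            using profileD(3)[OF \<Phi>] by (rule mult_left_mono)
          then show ?thesis
            using profileD(7)[OF \<Phi> a, of b' b] by (simp add: mult_ac)
        qed
        ultimately have "?X \<le> \<mu>"
        proof (cases "norm h / r ^ 3 \<le> 1")
          case True
          have "0 \<le> 2 * M * (norm h / r ^ 3)"
            using r profileD(2)[OF \<Phi>] by simp
          then show ?thesis
            using True \<open>?X \<le> 8 * L * (norm h / r ^ 3)\<close> by (simp only: \<mu>_def distrib_right min_absorb2)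
        next
          case False
          then show ?thesis
            using \<open>?X \<le> 2 * M\<close> profileD(3)[OF \<Phi>] by (simp add: \<mu>_def)
        qed
        then show ?thesis
          using inB rQ by (simp add: D divide_right_mono)
      qed
    next
      case False
      then show ?thesis
        using \<mu> rQ by (auto simp: p Delta_x_def profile_kernel_def Let_def a_def)
    qed
  qed
  note [measurable] = kin_box_borel
  have "L1_norm (Delta_x h (profile_kernel \<Phi> r))
      = (\<integral>\<^sup>+ p. ennreal (norm (Delta_x h (profile_kernel \<Phi> r) p)) \<partial>lborel)"
    using Delta_x_borel[OF profile_kernel_borel[OF profileD(1)[OF \<Phi>]]] by (simp add: L1_norm_def)
  also have "\<dots> \<le> (\<integral>\<^sup>+ p. ennreal (\<mu> / r ^ Q) * indicator ?B p \<partial>lborel)"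
  proof (intro nn_integral_mono)
    show "ennreal (norm (Delta_x h (profile_kernel \<Phi> r) p)) \<le> ennreal (\<mu> / r ^ Q) * indicator ?B p" for p
      using ennreal_leI[OF pointwise[of p]] by (cases "p \<in> ?B") auto
  qed
  also have "\<dots> = ennreal (\<mu> / r ^ Q) * emeasure lborel ?B"
    by (rule nn_integral_cmult_indicator) (simp add: kin_box_borel)
  also have "\<dots> \<le> ennreal (\<mu> / r ^ Q) * (emeasure lborel (kin_box r 0 :: 'n kpoint set) + emeasure lborel (kin_box r h))"
    by (intro mult_left_mono emeasure_subadditive) (simp_all add: kin_box_borel)
  also have "\<dots> = ennreal (\<mu> / r ^ Q * (2 * 48 ^ CARD('n) * r ^ Q))"
  proof -
    have "emeasure lborel (kin_box r k :: 'n kpoint set) = ennreal (48 ^ CARD('n) * r ^ Q)" for k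
      unfolding Q_def by (rule emeasure_kin_box[OF r])
    moreover have "ennreal x + ennreal x = ennreal (2 * x)" if "0 \<le> x" for x
      using ennreal_plus[OF that that] by simp
    ultimately show ?thesis
      using \<mu> rQ by (simp add: mult.assoc flip: ennreal_mult')
  qed
  also have "\<mu> / r ^ Q * (2 * 48 ^ CARD('n) * r ^ Q) = 2 * 48 ^ CARD('n) * (2 * M + 8 * L) * min 1 (norm h / r ^ 3)"
    using rQ by (simp add: \<mu>_def)
  finally show ?thesis .
qed

lemma K_ker_eq:
  fixes \<psi> :: "'n::finite kpoint \<Rightarrow> real"
  assumes "r > 0"
  shows "K_ker \<psi> r = profile_kernel (\<lambda>m. 2 ^ CARD('n) *\<^sub>R \<psi> m) r"
proof -
  have "matrix_inv (mat_A a r) = inv_A a r" if "a < -1" for a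
    using that assms by (intro matrix_inv_mat_A) auto
  then show ?thesis
    by (auto simp: K_ker_def profile_kernel_def Let_def fun_eq_iff)
qed

text \<open>
  Both entries of the row vector \<open>F\<^sub>a(r)\<close> are of order \<open>r\<^sup>0\<close>, so no further power of \<open>r\<close> appears.
\<close>

lemma K_vec_eq:
  fixes \<psi> :: "'n::finite kpoint \<Rightarrow> real"
  assumes "r > 0"
  shows "K_vec \<psi> r = profile_kernel
    (\<lambda>m. (- (2 ^ CARD('n)) * ((sin (ln r) + 2 * cos (ln r)) / fst m)) *\<^sub>R (\<psi> m *\<^sub>R fst (snd m))
       + (- (2 ^ CARD('n)) * (cos (ln r) - 2 * sin (ln r))) *\<^sub>R (\<psi> m *\<^sub>R snd (snd m))) r"
proof -
  have inv: "matrix_inv (mat_A a r) = inv_A a r" if "a < -1" for a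
    using that assms by (intro matrix_inv_mat_A) auto
  have alg: "(- (c / R * x)) *\<^sub>R (p *\<^sub>R u + q *\<^sub>R v)
      = (1 / R) *\<^sub>R ((- c * p) *\<^sub>R (x *\<^sub>R u) + (- c * q) *\<^sub>R (x *\<^sub>R v))"
    for c R x p q :: real and u v :: "real ^ 'n"
    by (simp add: scaleR_add_right scaleR_diff_right mult_ac)
  show ?thesis
    unfolding K_vec_def profile_kernel_def Let_def row_act_def case_prod_beta row_F_eq[OF assms]
      vector_2 fst_conv snd_conv
    by (rule ext) (simp only: inv alg greaterThanLessThan_iff cong: if_cong)
qed

text \<open>
  The second column of the inverse is of order \<open>r\<^sup>-\<^sup>1\<close>, and \<open>s r\<^sup>-\<^sup>1 r\<^sup>-\<^sup>1 = a\<close>.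
\<close>

lemma K_pi_eq:
  fixes \<psi> :: "'n::finite kpoint \<Rightarrow> real"
  assumes "r > 0"
  shows "K_pi \<psi> r = profile_kernel
    (\<lambda>m. (2 ^ (CARD('n) + 1) * fst m * (2 * fst m * cos (ln r))) *\<^sub>R grad_m1 \<psi> m
       + (2 ^ (CARD('n) + 1) * fst m * (- 2 * sin (ln r))) *\<^sub>R grad_m2 \<psi> m) r"
proof -
  define Q where "Q = hom_dim TYPE('n)"
  have inv: "matrix_inv (mat_A a r) = inv_A a r" if "a < -1" for a
    using that assms by (intro matrix_inv_mat_A) auto
  have alg: "(c * s / r ^ (Q + 1)) *\<^sub>R (inv_A (s / r ^ 2) r $ 1 $ 2 *\<^sub>R u + inv_A (s / r ^ 2) r $ 2 $ 2 *\<^sub>R v)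
      = (1 / r ^ Q) *\<^sub>R ((c * (s / r ^ 2) * (2 * (s / r ^ 2) * cos (ln r))) *\<^sub>R u
          + (c * (s / r ^ 2) * (- 2 * sin (ln r))) *\<^sub>R v)"
    for c s and u v :: "real ^ 'n"
    using assms by (simp add: inv_A_def scaleR_add_right field_simps power2_eq_square)
  show ?thesis
    unfolding K_pi_def profile_kernel_def Let_def case_prod_beta fst_conv Q_def[symmetric]
    by (rule ext) (simp only: inv alg greaterThanLessThan_iff cong: if_cong)
qed

theorem corollary2p4:
  fixes \<psi> :: "real \<times> (real ^ 'n) \<times> (real ^ 'n) \<Rightarrow> real"
  assumes psi_smooth: "C_infinity \<psi>"
    and psi_compact: "compact (supp \<psi>)"
    and psi_nonneg: "\<And>m. \<psi> m \<ge> 0"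
    and psi_integral: "integral\<^sup>L lborel \<psi> = 1"
    and psi_supp: "supp \<psi> \<subseteq> {-2<..<-1} \<times> ball 0 1 \<times> ball 0 1"
  shows "\<exists>C>0. \<forall>r>0. \<forall>h :: real ^ 'n.
           L1_norm (Delta_x h (K_ker \<psi> r)) + L1_norm (Delta_x h (K_pi \<psi> r))
             + L1_norm (Delta_x h (K_vec \<psi> r))
           \<le> ennreal (C * min 1 (norm h / r ^ 3))"
proof -
  note profiles = test_function_profiles[OF psi_smooth psi_compact psi_supp]
  obtain M0 L0 where p0: "profile M0 L0 \<psi>" using profiles(1) by blast
  obtain M1 L1 where p1: "profile M1 L1 (grad_m1 \<psi>)" using profiles(2) by blast
  obtain M2 L2 where p2: "profile M2 L2 (grad_m2 \<psi>)" using profiles(3) by blast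
  define D :: real where "D = 2 ^ CARD('n)"
  have D: "0 < D" by (simp add: D_def)

  have ker: "profile (D * M0) (D * L0) (\<lambda>m. D *\<^sub>R \<psi> m)"
    using D by (intro profile_scale[OF p0]) auto

  have q1: "profile M0 (M0 + L0) (\<lambda>m. \<psi> m *\<^sub>R fst (snd m))"
    by (rule profile_times_linear[OF p0 linear_fst]) (auto simp: norm_fst_le)
  have q2: "profile M0 (M0 + L0) (\<lambda>m. \<psi> m *\<^sub>R snd (snd m))"
    by (rule profile_times_linear[OF p0 linear_snd]) (auto simp: norm_snd_le)
  have vec: "profile (D * 3 * M0 + D * 3 * M0) (D * 3 * (M0 + L0) + D * 3 * (M0 + L0))
      (\<lambda>m. (- D * ((sin (ln r) + 2 * cos (ln r)) / fst m)) *\<^sub>R (\<psi> m *\<^sub>R fst (snd m))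
         + (- D * (cos (ln r) - 2 * sin (ln r))) *\<^sub>R (\<psi> m *\<^sub>R snd (snd m)))" for r
  proof (intro profile_add profile_scale[OF q1] profile_scale[OF q2])
    fix a :: real assume a: "-2 < a" "a < -1"
    have "\<bar>sin (ln r) + 2 * cos (ln r)\<bar> / \<bar>a\<bar> \<le> 3 / 1"
      using abs_lin_sin_cos_le[of 1 "ln r" 2] a by (intro frac_le) auto
    from mult_left_mono[OF this, of D] D
    show "\<bar>- D * ((sin (ln r) + 2 * cos (ln r)) / a)\<bar> \<le> D * 3"
      by (simp add: abs_mult)
    show "\<bar>- D * (cos (ln r) - 2 * sin (ln r))\<bar> \<le> D * 3"
      using D abs_lin_sin_cos_le[of "-2" "ln r" 1] by (simp add: abs_mult)
  qed (use D in auto)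

  have pi: "profile (D * 16 * M1 + D * 16 * M2) (D * 16 * L1 + D * 16 * L2)
      (\<lambda>m. (2 * D * fst m * (2 * fst m * cos (ln r))) *\<^sub>R grad_m1 \<psi> m
         + (2 * D * fst m * (- 2 * sin (ln r))) *\<^sub>R grad_m2 \<psi> m)" for r
  proof (intro profile_add profile_scale[OF p1] profile_scale[OF p2])
    fix a :: real assume a: "-2 < a" "a < -1"
    have 1: "\<bar>2 * D * a\<bar> \<le> 4 * D"
      using mult_left_mono[of "\<bar>a\<bar>" 2 "2 * D"] a D by (simp add: abs_mult)
    have 2: "\<bar>2 * a * cos (ln r)\<bar> \<le> 4"
      using mult_mono[of "\<bar>2 * a\<bar>" 4 "\<bar>cos (ln r)\<bar>" 1] a by (simp add: abs_mult)
    have 3: "\<bar>- 2 * sin (ln r)\<bar> \<le> 4"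
      using abs_sin_le_one[of "ln r"] by linarith
    show "\<bar>2 * D * a * (2 * a * cos (ln r))\<bar> \<le> D * 16"
      using mult_mono[OF 1 2] D by (simp only: abs_mult) simp
    show "\<bar>2 * D * a * (- 2 * sin (ln r))\<bar> \<le> D * 16"
      using mult_mono[OF 1 3] D by (simp only: abs_mult) simp
  qed (use D in auto)

  define V :: real where "V = 2 * 48 ^ CARD('n)"
  define c where "c M L = V * (2 * M + 8 * L)" for M L
  have c_nonneg: "0 \<le> c M L" if "profile M L \<Phi>" for M L and \<Phi> :: "'n kpoint \<Rightarrow> 'b::euclidean_space"
    using profileD(2,3)[OF that] by (simp add: c_def V_def)
  define C1 C2 C3 where "C1 = c (D * M0) (D * L0)"
    and "C2 = c (D * 16 * M1 + D * 16 * M2) (D * 16 * L1 + D * 16 * L2)"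
    and "C3 = c (D * 3 * M0 + D * 3 * M0) (D * 3 * (M0 + L0) + D * 3 * (M0 + L0))"
  have nonneg: "0 \<le> C1" "0 \<le> C2" "0 \<le> C3"
    unfolding C1_def C2_def C3_def using c_nonneg[OF ker] c_nonneg[OF pi] c_nonneg[OF vec] .
  have "L1_norm (Delta_x h (K_ker \<psi> r)) + L1_norm (Delta_x h (K_pi \<psi> r))
      + L1_norm (Delta_x h (K_vec \<psi> r)) \<le> ennreal ((C1 + C2 + C3 + 1) * min 1 (norm h / r ^ 3))"
    if r: "r > 0" for r and h :: "real ^ 'n"
  proof -
    define t where "t = min 1 (norm h / r ^ 3)"
    have t: "0 \<le> t" using r by (simp add: t_def)
    have "L1_norm (Delta_x h (K_ker \<psi> r)) \<le> ennreal (C1 * t)"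
      using L1_norm_Delta_x_profile_kernel[OF ker r]
      by (simp add: K_ker_eq[OF r] D_def C1_def c_def V_def t_def)
    moreover have "L1_norm (Delta_x h (K_pi \<psi> r)) \<le> ennreal (C2 * t)"
      using L1_norm_Delta_x_profile_kernel[OF pi r]
      by (simp add: K_pi_eq[OF r] D_def C2_def c_def V_def t_def)
    moreover have "L1_norm (Delta_x h (K_vec \<psi> r)) \<le> ennreal (C3 * t)"
      using L1_norm_Delta_x_profile_kernel[OF vec r]
      by (simp add: K_vec_eq[OF r] D_def C3_def c_def V_def t_def)
    ultimately have "L1_norm (Delta_x h (K_ker \<psi> r)) + L1_norm (Delta_x h (K_pi \<psi> r))
        + L1_norm (Delta_x h (K_vec \<psi> r)) \<le> ennreal (C1 * t) + ennreal (C2 * t) + ennreal (C3 * t)"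
      by (intro add_mono)
    also have "\<dots> = ennreal ((C1 + C2 + C3) * t)"
      using nonneg t by (simp add: distrib_right flip: ennreal_plus)
    also have "\<dots> \<le> ennreal ((C1 + C2 + C3 + 1) * t)"
      using t by (intro ennreal_leI mult_right_mono) auto
    finally show ?thesis by (simp add: t_def)
  qed
  then show ?thesis
    using nonneg by (intro exI[of _ "C1 + C2 + C3 + 1"]) auto
qed

end
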